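(* For any positive integer $k$, there exists a $k$-tuple of integers $H_k$ such that $H_k$ is admissible and $H_k$ is difference $k$-smooth.
   Context: An integer is $y$-smooth if its largest prime factor is less than or equal to $y$; equivalently, every prime dividing it is at most $y$ (so $\pm1$ are $y$-smooth, the sign is irrelevant, and $0$, being divisible by every prime, is not $y$-smooth). $\mathcal{S}(y)$ denotes the set of all $y$-smooth integers. A $k$-tuple of integers $H_k$ is admissible if, for every prime $p$, the elements of $H_k$ do not cover all congruence classes modulo $p$. A tuple $H=(h_1,\ldots,h_k)$ is difference $y$-smooth if $h_i-h_j\in\mathcal{S}(y)$ for every pair of elements $h_i,h_j$ of $H$ with $i\ne j$. (In particular the entries of such a tuple are distinct.) *)

theory Defs
  imports "HOL-Number_Theory.Number_Theory"
begin

text \<open>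
  The sign of an integer is irrelevant here. Units are smooth for every \<open>y\<close>, and \<open>0\<close> is
  smooth for no \<open>y\<close>, because every prime divides it.
\<close>

definition smooth_ints :: "nat \<Rightarrow> int set" where
  "smooth_ints y = {n. \<forall>p::nat. prime p \<and> int p dvd n \<longrightarrow> p \<le> y}"

text \<open>A \<open>k\<close>-tuple of integers is a list of length \<open>k\<close>.\<close>

definition admissible :: "int list \<Rightarrow> bool" where
  "admissible H \<longleftrightarrow>
     (\<forall>p::nat. prime p \<longrightarrow> \<not> (\<forall>r::int. \<exists>h\<in>set H. [h = r] (mod int p)))"

text \<open>
  The condition ranges over pairs of distinct positions, not of distinct values; as \<open>0\<close> is
  not smooth, it forces the entries to be distinct.
\<close>

definition difference_smooth :: "nat \<Rightarrow> int list \<Rightarrow> bool" where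
  "difference_smooth y H \<longleftrightarrow>
     (\<forall>i < length H. \<forall>j < length H. i \<noteq> j \<longrightarrow> H ! i - H ! j \<in> smooth_ints y)"

end

theory Submission
  imports Defs
begin

text \<open>
  The tuple consists of the first \<open>k\<close> multiples of \<open>k!\<close>. Every prime up to \<open>k\<close> divides \<open>k!\<close>, so
  modulo such a prime all entries fall into the single class of \<open>0\<close>; a prime above \<open>k\<close> has
  more classes than the tuple has entries. Either way some class is missed. The difference of two
  distinct entries is \<open>k!\<close> times a nonzero integer of absolute value less than \<open>k\<close>, and all prime
  factors of both factors are at most \<open>k\<close>.
\<close>

text \<open>
  Primes above the length are handled by counting residues, so only the small primes carry a
  condition. For these, entries divisible by \<open>p\<close> leave the class of \<open>1\<close> uncovered, as \<open>p \<noteq> 1\<close>.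
\<close>

lemma admissible_if_small_primes_dvd:
  fixes H :: "int list"
  assumes dvd: "\<And>p h. \<lbrakk>prime p; p \<le> length H; h \<in> set H\<rbrakk> \<Longrightarrow> int p dvd h"
  shows "admissible H"
  unfolding admissible_def
proof (intro allI impI notI)
  fix p :: nat
  assume p: "prime p" and cover: "\<forall>r::int. \<exists>h\<in>set H. [h = r] (mod int p)"
  show False
  proof (cases "p \<le> length H")
    case True
    obtain h where h: "h \<in> set H" "[h = 1] (mod int p)"
      using cover by blast
    have "int p dvd h"
      using dvd p True h(1) by blast
    then have "int p dvd 1"
      using h(2) cong_dvd_iff cong_sym by blast
    then show False
      using p by (simp add: prime_nat_iff)
  next
    case False
    have "{0..<int p} \<subseteq> (\<lambda>h. h mod int p) ` set H"
    proof
      fix r assume r: "r \<in> {0..<int p}"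
      obtain h where "h \<in> set H" "[h = r] (mod int p)"
        using cover by blast
      with r show "r \<in> (\<lambda>h. h mod int p) ` set H"
        by (force simp: cong_def)
    qed
    then have "card {0..<int p} \<le> card (set H)"
      by (rule surj_card_le[OF finite_set])
    also have "\<dots> \<le> length H"
      by (rule card_length)
    finally show False
      using False by simp
  qed
qed

lemma smooth_ints_mult:
  assumes "a \<in> smooth_ints y" "b \<in> smooth_ints y"
  shows "a * b \<in> smooth_ints y"
  using assms unfolding smooth_ints_def by (auto simp: prime_dvd_mult_iff)

lemma smooth_ints_if_abs_le:
  assumes "n \<noteq> 0" "\<bar>n\<bar> \<le> int y"
  shows "n \<in> smooth_ints y"
proof -
  have "p \<le> y" if "int p dvd n" for p
    using dvd_imp_le_int[OF assms(1) that] assms(2) by linarith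
  then show ?thesis
    by (simp add: smooth_ints_def)
qed

lemma int_prime_dvd_fact_iff:
  assumes "prime p"
  shows "int p dvd fact n \<longleftrightarrow> p \<le> n"
proof -
  have "int p dvd fact n \<longleftrightarrow> int p dvd int (fact n)"
    by (simp only: of_nat_fact)
  also have "\<dots> \<longleftrightarrow> p dvd fact n"
    by (rule int_dvd_int_iff)
  also have "\<dots> \<longleftrightarrow> p \<le> n"
    using assms by (rule prime_dvd_fact_iff)
  finally show ?thesis .
qed

lemma fact_in_smooth_ints: "fact y \<in> smooth_ints y"
  by (auto simp: smooth_ints_def int_prime_dvd_fact_iff)

theorem theorem1p4:
  fixes k :: nat
  assumes "k > 0"
  shows "\<exists>H :: int list. length H = k \<and> admissible H \<and> difference_smooth k H"
proof -
  define H :: "int list" where "H = map (\<lambda>i. fact k * int i) [0..<k]"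
  have len: "length H = k"
    by (simp add: H_def)
  have "admissible H"
  proof (rule admissible_if_small_primes_dvd)
    fix p h assume "prime p" "p \<le> length H" "h \<in> set H"
    moreover from this have "int p dvd fact k"
      by (simp add: int_prime_dvd_fact_iff len)
    ultimately show "int p dvd h"
      by (auto simp: H_def)
  qed
  moreover have "difference_smooth k H"
    unfolding difference_smooth_def
  proof (intro allI impI)
    fix i j assume ij: "i < length H" "j < length H" "i \<noteq> j"
    then have "H ! i - H ! j = fact k * (int i - int j)"
      by (simp add: H_def right_diff_distrib)
    moreover have "int i - int j \<in> smooth_ints k"
      by (rule smooth_ints_if_abs_le) (use ij len in auto)
    ultimately show "H ! i - H ! j \<in> smooth_ints k"
      by (simp add: smooth_ints_mult fact_in_smooth_ints)
  qed
  ultimately show ?thesis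
    using len by blast
qed

end
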